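(* Assume that $n(m) < \infty$ for every positive integer $m$. Let $N \geq 2$ be an integer, write $n = n(N)$, let $$T_N := \{n+1\} \cup \{ j \in \{1,\dots,n\} : c^{n-j}(N) \text{ is odd} \},$$ and let $d_N := \gcd(j : j \in T_N)$. Then the upper bound $|z_N| \leq 2$ for the roots $z_N$ of the Collatz polynomial $P_N$ is an equality (that is, $P_N$ has a root of modulus exactly $2$) if and only if $d_N > 1$. In that case: 1. the zeros of $P_N$ on $\{z \in \mathbb{C} : |z| = 2\}$ are simple and are given precisely by $\{2\omega : \omega \in \mathbb{C},\ \omega^{d_N} = 1,\ \omega \neq 1\}$; and 2. $P_N$ factors as $$P_N(2z) = (1 + z + \cdots + z^{d_N - 1}) \cdot Q_N(z^{d_N}),$$ where $Q_N$ is a polynomial with positive coefficients. Moreover, if $Q_N$ is non-constant, then all its zeros lie in the open unit disk $\mathbb{D}$ and $\beta[Q_N] \leq 1$.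
   Context: For a non-negative integer $N$ define $c(N) = N/2$ if $N$ is even, $c(N) = (3N+1)/2$ if $N$ is odd and $N \neq 1$, and $c(1) = 0$. Put $c^0(N) = N$ and $c^j(N) = c(c^{j-1}(N))$ for $j \geq 1$. Let $n(N) = \min\{ j \geq 0 : c^j(N) = 1\}$ (with $n(N)=\infty$ if there is no such $j$). Standing assumption: $n(N) < \infty$ for all positive integers $N$. The $N$th Collatz polynomial is $P_N(z) = \sum_{j=0}^{n(N)} c^j(N)\, z^j$. For a polynomial $f(z) = a_k z^k + \cdots + a_1 z + a_0$ of degree $k \geq 1$ with all coefficients $a_0,\dots,a_k$ strictly positive, $\beta[f] := \max_{0 \leq j \leq k-1} \frac{a_j}{a_{j+1}}$. *)

theory Defs
  imports
    Complex_Main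
    "HOL-Library.Extended_Nat"
    "HOL-Computational_Algebra.Polynomial"
begin

definition collatz :: "nat \<Rightarrow> nat" where
  "collatz N = (if even N then N div 2 else if N = 1 then 0 else (3 * N + 1) div 2)"

definition collatz_time :: "nat \<Rightarrow> enat" where
  "collatz_time N =
     (if \<exists>j. (collatz ^^ j) N = 1 then enat (LEAST j. (collatz ^^ j) N = 1) else \<infinity>)"

text \<open>
  The following two definitions are meaningful only if \<^term>\<open>collatz_time N < \<infinity>\<close>,
  since \<^const>\<open>the_enat\<close> is unspecified at \<^term>\<open>\<infinity>\<close>.
\<close>

definition collatz_poly :: "nat \<Rightarrow> real poly" where
  "collatz_poly N = (\<Sum>j\<le>the_enat (collatz_time N). monom (of_nat ((collatz ^^ j) N)) j)"

definition collatz_T :: "nat \<Rightarrow> nat set" where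
  "collatz_T N = (let n = the_enat (collatz_time N) in
     {n + 1} \<union> {j \<in> {1..n}. odd ((collatz ^^ (n - j)) N)})"

definition collatz_d :: "nat \<Rightarrow> nat" where
  "collatz_d N = Gcd (collatz_T N)"

definition pos_coeffs :: "real poly \<Rightarrow> bool" where
  "pos_coeffs f \<longleftrightarrow> (\<forall>j\<le>degree f. coeff f j > 0)"

text \<open>Used only for non-constant polynomials with positive coefficients.\<close>

definition coeff_ratio_max :: "real poly \<Rightarrow> real" where
  "coeff_ratio_max f = Max ((\<lambda>j. coeff f j / coeff f (j + 1)) ` {0..degree f - 1})"

abbreviation cpoly :: "real poly \<Rightarrow> complex poly" where
  "cpoly f \<equiv> map_poly complex_of_real f"

end

theory Submission
  imports Defs
begin

text \<open>
  The coefficients \<open>a\<^sub>j = 2\<^sup>j c\<^sup>j(N)\<close> of \<open>f(z) = P\<^sub>N(2z)\<close> never decrease: an even iterate leaves the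
  coefficient unchanged, an odd one makes it strictly larger. Everything else is the theory of
  equality in the Enestrom--Kakeya theorem for such a polynomial \<open>f\<close> of degree \<open>n\<close>. With
  \<open>b\<^sub>j = a\<^sub>j - a\<^sub>j\<^sub>-\<^sub>1 \<ge> 0\<close> (and \<open>a\<^sub>-\<^sub>1 = 0\<close>) one has

  \<open>(1 - z) f(z) = (\<Sum>j\<le>n. b\<^sub>j z\<^sup>j) - a\<^sub>n z\<^sup>n\<^sup>+\<^sup>1\<close>  and  \<open>(\<Sum>j\<le>n. b\<^sub>j) = a\<^sub>n\<close>.

  So at a root of modulus \<open>1\<close> the triangle inequality for \<open>\<Sum>j\<le>n. b\<^sub>j z\<^sup>j\<close> is an equality, and all the
  powers \<open>z\<^sup>j\<close> with \<open>b\<^sub>j > 0\<close> coincide with \<open>z\<^sup>n\<^sup>+\<^sup>1\<close>. Equivalently, \<open>z\<^sup>d = 1\<close> for the greatest common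
  divisor \<open>d\<close> of the gaps \<open>n + 1 - j\<close> with \<open>b\<^sub>j > 0\<close>; conversely every \<open>z \<noteq> 1\<close> with \<open>z\<^sup>d = 1\<close> is a root
  (\<open>unit_root_iff\<close>). For the Collatz polynomial these gaps form the set \<open>T\<^sub>N\<close>. At such a root the derivative of the right-hand side is a nonzero multiple of
  \<open>(\<Sum>j\<le>n. j b\<^sub>j) - (n + 1) a\<^sub>n < 0\<close>, so that the root is simple (\<open>pderiv_unit_root\<close>).

  Since \<open>d\<close> divides \<open>n + 1\<close> (the gap at \<open>j = 0\<close>), the increments sit at multiples of \<open>d\<close>. The
  coefficient sequence therefore consists of constant blocks of length \<open>d\<close>, which is the factorization
  \<open>f(z) = (1 + z + \<dots> + z\<^sup>d\<^sup>-\<^sup>1) Q(z\<^sup>d)\<close>, where \<open>Q\<close> lists the block values (\<open>block_factorization\<close>). A root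
  \<open>w\<close> of \<open>Q\<close> with \<open>|w| \<ge> 1\<close> would give a root \<open>z\<close> of \<open>f\<close> with \<open>z\<^sup>d = w\<close>, hence \<open>|z| = 1\<close> and \<open>w = 1\<close>; but
  \<open>Q(1) > 0\<close>.
\<close>

section \<open>Evaluation of real polynomials at complex points\<close>

lemma poly_cpoly: "poly (cpoly p) z = (\<Sum>j\<le>degree p. of_real (coeff p j) * z ^ j)"
  by (simp add: poly_altdef degree_map_poly coeff_map_poly)

lemma cpoly_mult: "cpoly (p * q) = cpoly p * cpoly q"
  by (rule poly_eqI) (simp add: coeff_map_poly coeff_mult)

lemma cpoly_pcompose: "cpoly (pcompose p q) = pcompose (cpoly p) (cpoly q)"
proof (induction p)
  case (pCons a p)
  have "cpoly ([:a:] + q * pcompose p q) = [:of_real a:] + cpoly q * cpoly (pcompose p q)"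
    unfolding cpoly_mult [symmetric]
    by (rule poly_eqI) (simp add: coeff_map_poly coeff_pCons split: nat.split)
  with pCons show ?case
    by (simp add: pcompose_pCons map_poly_pCons)
qed simp

lemma pos_coeffs_poly_1:
  assumes "pos_coeffs Q"
  shows "poly Q 1 > 0"
  using assms unfolding poly_altdef pos_coeffs_def by (auto intro!: sum_pos)

section \<open>Polynomials with nondecreasing coefficients\<close>

definition nondecreasing_coeffs :: "real poly \<Rightarrow> bool" where
  "nondecreasing_coeffs f \<longleftrightarrow>
     coeff f 0 > 0 \<and> (\<forall>j<degree f. coeff f j \<le> coeff f (Suc j))"

definition increment :: "real poly \<Rightarrow> nat \<Rightarrow> real" where
  "increment f j = coeff f j - (if j = 0 then 0 else coeff f (j - 1))"

text \<open>
  Gaps are measured down from \<open>degree f + 1\<close>, the exponent of the negative term of \<open>(1 - z) f(z)\<close>.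
\<close>

definition increment_gaps :: "real poly \<Rightarrow> nat set" where
  "increment_gaps f = (\<lambda>j. Suc (degree f) - j) ` {j. j \<le> degree f \<and> increment f j \<noteq> 0}"

lemma increment_nonneg:
  assumes "nondecreasing_coeffs f" "j \<le> degree f"
  shows "increment f j \<ge> 0"
  using assms by (cases j) (auto simp: nondecreasing_coeffs_def increment_def)

lemma sum_increment: "(\<Sum>j\<le>k. increment f j) = coeff f k"
  by (induction k) (simp_all add: increment_def)

lemma pos_coeffs_if_nondecreasing:
  assumes "nondecreasing_coeffs f"
  shows "pos_coeffs f"
  unfolding pos_coeffs_def
proof (intro allI impI)
  fix j assume "j \<le> degree f"
  then show "coeff f j > 0"
    using assms unfolding nondecreasing_coeffs_def by (induction j) (auto intro: less_le_trans)
qed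

lemma cpoly_times_one_minus:
  "[:1, -1:] * cpoly f =
     (\<Sum>j\<le>degree f. monom (of_real (increment f j)) j)
       - monom (of_real (lead_coeff f)) (Suc (degree f))"
proof (rule poly_eqI)
  fix k
  show "coeff ([:1, -1:] * cpoly f) k =
      coeff ((\<Sum>j\<le>degree f. monom (of_real (increment f j)) j)
        - monom (of_real (lead_coeff f)) (Suc (degree f))) k"
    by (cases k) (auto simp: coeff_sum coeff_map_poly increment_def coeff_eq_0)
qed

lemma poly_times_one_minus:
  "(1 - z) * poly (cpoly f) z =
     (\<Sum>j\<le>degree f. of_real (increment f j) * z ^ j)
       - of_real (lead_coeff f) * z ^ Suc (degree f)"
  using arg_cong[OF cpoly_times_one_minus[of f], of "\<lambda>p. poly p z"]
  by (simp add: poly_sum poly_monom algebra_simps)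

text \<open>The Enestrom--Kakeya bound: outside the closed unit disk the top term dominates.\<close>

lemma root_norm_le_1:
  assumes f: "nondecreasing_coeffs f" and root: "poly (cpoly f) z = 0"
  shows "cmod z \<le> 1"
proof (rule ccontr)
  assume "\<not> cmod z \<le> 1"
  then have z: "cmod z > 1" by simp
  let ?n = "degree f"
  have a: "lead_coeff f > 0"
    using pos_coeffs_if_nondecreasing[OF f] by (simp add: pos_coeffs_def)
  have "cmod (of_real (lead_coeff f) * z ^ Suc ?n) =
      cmod (\<Sum>j\<le>?n. of_real (increment f j) * z ^ j)"
    using poly_times_one_minus[of z f] root by simp
  then have "lead_coeff f * cmod z ^ Suc ?n = cmod (\<Sum>j\<le>?n. of_real (increment f j) * z ^ j)"
    using a by (simp add: norm_mult norm_power)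
  also have "\<dots> \<le> (\<Sum>j\<le>?n. increment f j * cmod z ^ j)"
    by (rule sum_norm_le) (simp add: norm_mult norm_power increment_nonneg[OF f])
  also have "\<dots> \<le> (\<Sum>j\<le>?n. increment f j * cmod z ^ ?n)"
    using z by (intro sum_mono mult_left_mono increment_nonneg[OF f] power_increasing) auto
  also have "\<dots> = lead_coeff f * cmod z ^ ?n"
    by (simp add: sum_distrib_right [symmetric] sum_increment)
  finally have "cmod z ^ Suc ?n \<le> cmod z ^ ?n"
    using a by simp
  then show False
    using z power_strict_increasing[of ?n "Suc ?n" "cmod z"] by simp
qed

section \<open>Roots of modulus one\<close>

text \<open>
  The equality case of the triangle inequality: comparing real parts after division by \<open>u\<close> writes
  \<open>0\<close> as a sum of the nonnegative terms \<open>b j * (1 - Re (w j / u))\<close>.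
\<close>

lemma weighted_sum_of_units_extremal:
  fixes b :: "'a \<Rightarrow> real" and w :: "'a \<Rightarrow> complex"
  assumes "finite A" and b: "\<And>j. j \<in> A \<Longrightarrow> b j \<ge> 0"
    and w: "\<And>j. j \<in> A \<Longrightarrow> cmod (w j) = 1" and u: "cmod u = 1"
    and eq: "(\<Sum>j\<in>A. of_real (b j) * w j) = of_real (\<Sum>j\<in>A. b j) * u"
    and j: "j \<in> A" "b j \<noteq> 0"
  shows "w j = u"
proof -
  have u0: "u \<noteq> 0" using u by auto
  have "(\<Sum>j\<in>A. of_real (b j) * (w j / u)) = of_real (\<Sum>j\<in>A. b j)"
    using eq u0 by (simp add: sum_divide_distrib [symmetric] field_simps)
  then have "Re (\<Sum>j\<in>A. of_real (b j) * (w j / u)) = (\<Sum>j\<in>A. b j)"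
    by (metis Re_complex_of_real)
  moreover have "Re (of_real (b i) * (w i / u)) = b i * Re (w i / u)" for i
    by (simp only: Re_complex_of_real Im_complex_of_real times_complex.sel mult_zero_left diff_zero)
  ultimately have "(\<Sum>j\<in>A. b j * Re (w j / u)) = (\<Sum>j\<in>A. b j)"
    by (simp only: Re_sum)
  then have "(\<Sum>j\<in>A. b j * (1 - Re (w j / u))) = 0"
    by (simp add: right_diff_distrib sum_subtractf)
  moreover have le: "Re (w i / u) \<le> 1" if "i \<in> A" for i
    using complex_Re_le_cmod[of "w i / u"] w[OF that] u by (simp add: norm_divide)
  ultimately have "b j * (1 - Re (w j / u)) = 0"
    using \<open>finite A\<close> j(1) b by (subst (asm) sum_nonneg_eq_0_iff) auto
  then have re: "Re (w j / u) = 1"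
    using j by simp
  moreover have "cmod (w j / u) = 1"
    using w[OF j(1)] u by (simp add: norm_divide)
  ultimately have "Im (w j / u) = 0"
    by (simp add: cmod_def)
  with re have "w j / u = 1"
    by (simp add: complex_eq_iff)
  then show ?thesis using u0 by simp
qed

lemma power_gcd_eq_1:
  fixes z :: "'a :: monoid_mult"
  assumes a: "z ^ a = 1" and b: "z ^ b = 1"
  shows "z ^ gcd a b = 1"
proof (cases "a = 0")
  case False
  then obtain x y where xy: "a * x = b * y + gcd a b"
    using bezout_nat by blast
  have "1 = z ^ (a * x)" using a by (simp add: power_mult)
  also have "\<dots> = z ^ gcd a b" using b by (simp add: xy power_add power_mult)
  finally show ?thesis ..
qed (use b in simp)

lemma power_Gcd_eq_1:
  fixes z :: "'a :: monoid_mult"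
  assumes "finite T" "\<And>t. t \<in> T \<Longrightarrow> z ^ t = 1"
  shows "z ^ Gcd T = 1"
  using assms by (induction T rule: finite_induct) (auto intro: power_gcd_eq_1)

lemma Suc_degree_in_increment_gaps:
  assumes "nondecreasing_coeffs f"
  shows "Suc (degree f) \<in> increment_gaps f"
  using assms unfolding increment_gaps_def
  by (intro image_eqI[where x = 0]) (auto simp: increment_def nondecreasing_coeffs_def)

lemma Gcd_increment_gaps_pos:
  assumes "nondecreasing_coeffs f"
  shows "Gcd (increment_gaps f) > 0"
  using Suc_degree_in_increment_gaps[OF assms]
  by (metis Gcd_0_iff gr0I insert_absorb insert_subset nat.distinct(1) singletonD subset_iff)

lemma Gcd_increment_gaps_dvd:
  assumes f: "nondecreasing_coeffs f"
  shows "Gcd (increment_gaps f) dvd Suc (degree f)"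
    and "j \<le> degree f \<Longrightarrow> increment f j \<noteq> 0 \<Longrightarrow> Gcd (increment_gaps f) dvd j"
proof -
  let ?d = "Gcd (increment_gaps f)"
  show n: "?d dvd Suc (degree f)"
    using Suc_degree_in_increment_gaps[OF f] by simp
  assume j: "j \<le> degree f" "increment f j \<noteq> 0"
  then have "?d dvd Suc (degree f) - j"
    by (intro Gcd_dvd) (auto simp: increment_gaps_def)
  with n j(1) show "?d dvd j"
    by (meson dvd_diffD1 le_SucI)
qed

lemma unit_root_power_eq_1:
  assumes f: "nondecreasing_coeffs f" and root: "poly (cpoly f) z = 0" and z: "cmod z = 1"
  shows "z ^ Gcd (increment_gaps f) = 1"
proof (rule power_Gcd_eq_1)
  show "finite (increment_gaps f)"
    by (simp add: increment_gaps_def)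
  fix t assume "t \<in> increment_gaps f"
  then obtain j where j: "j \<le> degree f" "increment f j \<noteq> 0" and t: "t = Suc (degree f) - j"
    by (auto simp: increment_gaps_def)
  have "z ^ j = z ^ Suc (degree f)"
  proof (rule weighted_sum_of_units_extremal[where A = "{..degree f}" and b = "increment f"])
    show "(\<Sum>j\<le>degree f. of_real (increment f j) * z ^ j) =
        of_real (\<Sum>j\<le>degree f. increment f j) * z ^ Suc (degree f)"
      using poly_times_one_minus[of z f] root unfolding sum_increment by simp
  qed (use j z increment_nonneg[OF f] in \<open>auto simp: norm_power norm_mult\<close>)
  moreover have "z ^ Suc (degree f) = z ^ j * z ^ t"
    using j(1) by (simp add: t power_add [symmetric] del: power_Suc)
  moreover have "z \<noteq> 0" using z by auto
  ultimately show "z ^ t = 1" by simp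
qed

text \<open>
  At a \<open>d\<close>-th root of unity all powers on the right-hand side of \<open>poly_times_one_minus\<close> with a nonzero
  coefficient are \<open>1\<close>, and the coefficients sum to \<open>0\<close>. The factor \<open>1 - z\<close> accounts for the exception
  \<open>z = 1\<close>, where \<open>f\<close> is positive.
\<close>

lemma unit_root_iff:
  assumes f: "nondecreasing_coeffs f"
  shows "poly (cpoly f) z = 0 \<and> cmod z = 1 \<longleftrightarrow> z ^ Gcd (increment_gaps f) = 1 \<and> z \<noteq> 1"
    (is "_ \<longleftrightarrow> z ^ ?d = 1 \<and> _")
proof safe
  assume "poly (cpoly f) z = 0" "cmod z = 1"
  then show "z ^ ?d = 1" by (rule unit_root_power_eq_1[OF f])
next
  assume "poly (cpoly f) 1 = 0"
  moreover have "poly (cpoly f) 1 = of_real (poly f 1)"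
    unfolding poly_cpoly by (simp add: poly_altdef)
  ultimately show False
    using pos_coeffs_poly_1[OF pos_coeffs_if_nondecreasing[OF f]] by simp
next
  assume d: "z ^ ?d = 1"
  have "cmod z ^ ?d = 1" using d by (metis norm_one norm_power)
  then show "cmod z = 1"
    using Gcd_increment_gaps_pos[OF f] by (metis norm_ge_zero power_eq_imp_eq_base power_one zero_le_one)
  assume z: "z \<noteq> 1"
  have pow: "z ^ j = 1" if "?d dvd j" for j
    using that d by (auto simp: power_mult)
  have "(\<Sum>j\<le>degree f. of_real (increment f j) * z ^ j) =
      (\<Sum>j\<le>degree f. complex_of_real (increment f j))"
    using pow Gcd_increment_gaps_dvd(2)[OF f] by (intro sum.cong) fastforce+
  also have "\<dots> = of_real (lead_coeff f)"
    unfolding of_real_sum [symmetric] sum_increment ..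
  finally have "(1 - z) * poly (cpoly f) z = 0"
    using pow[OF Gcd_increment_gaps_dvd(1)[OF f]] by (simp add: poly_times_one_minus)
  then show "poly (cpoly f) z = 0" using z by simp
qed

text \<open>
  All powers of \<open>z\<close> that survive in \<open>z * ((1 - z) f(z))'\<close> are equal to \<open>1\<close>, so this number is the
  real number \<open>(\<Sum>j\<le>n. j b\<^sub>j) - (n + 1) a\<^sub>n\<close>, which is at most \<open>n a\<^sub>n - (n + 1) a\<^sub>n\<close>.
\<close>

lemma pderiv_unit_root:
  assumes f: "nondecreasing_coeffs f" and root: "poly (cpoly f) z = 0" and z: "cmod z = 1"
  shows "poly (pderiv (cpoly f)) z \<noteq> 0"
proof
  assume deriv: "poly (pderiv (cpoly f)) z = 0"
  let ?d = "Gcd (increment_gaps f)" and ?n = "degree f"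
  have pow: "z ^ j = 1" if "?d dvd j" for j
    using that unit_root_power_eq_1[OF assms] by (auto simp: power_mult)
  have "poly (pderiv ([:1, -1:] * cpoly f)) z = 0"
    using root deriv by (simp only: pderiv_mult poly_add poly_mult) simp
  then have "0 = z * poly (pderiv ([:1, -1:] * cpoly f)) z" by simp
  also have "\<dots> = (\<Sum>j\<le>?n. z * (of_nat j * of_real (increment f j) * z ^ (j - 1)))
      - z * (of_nat (Suc ?n) * of_real (lead_coeff f) * z ^ ?n)"
    unfolding cpoly_times_one_minus
    by (simp add: pderiv_diff higher_pderiv_sum[of 1, simplified] pderiv_monom poly_sum poly_monom sum_distrib_left
        right_diff_distrib del: of_nat_Suc)
  also have "(\<Sum>j\<le>?n. z * (of_nat j * of_real (increment f j) * z ^ (j - 1))) =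
      (\<Sum>j\<le>?n. of_real (real j * increment f j))"
  proof (rule sum.cong)
    fix j assume "j \<in> {..?n}"
    then have "increment f j = 0 \<or> z ^ j = 1"
      using pow Gcd_increment_gaps_dvd(2)[OF f] by auto
    then show "z * (of_nat j * of_real (increment f j) * z ^ (j - 1)) =
        of_real (real j * increment f j)"
      by (cases j) (auto simp: mult.left_commute[of z])
  qed simp
  also have "z * (of_nat (Suc ?n) * of_real (lead_coeff f) * z ^ ?n) =
      of_real (real (Suc ?n) * lead_coeff f) * z ^ Suc ?n"
    by simp
  also have "z ^ Suc ?n = 1"
    using pow[OF Gcd_increment_gaps_dvd(1)[OF f]] .
  finally have "complex_of_real 0 =
      of_real ((\<Sum>j\<le>?n. real j * increment f j) - real (Suc ?n) * lead_coeff f)"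
    by simp
  then have "real (Suc ?n) * lead_coeff f = (\<Sum>j\<le>?n. real j * increment f j)"
    by (simp only: of_real_eq_iff)
  also have "\<dots> \<le> (\<Sum>j\<le>?n. real ?n * increment f j)"
    by (intro sum_mono mult_right_mono increment_nonneg[OF f]) auto
  also have "\<dots> = real ?n * lead_coeff f"
    by (simp add: sum_distrib_left [symmetric] sum_increment)
  finally have "lead_coeff f \<le> 0"
    by (simp add: algebra_simps)
  moreover have "lead_coeff f > 0"
    using pos_coeffs_if_nondecreasing[OF f] by (simp add: pos_coeffs_def)
  ultimately show False by simp
qed

section \<open>Factorization through the blocks of equal coefficients\<close>

definition block_poly :: "nat \<Rightarrow> real poly \<Rightarrow> real poly" where
  "block_poly d f = (\<Sum>k<Suc (degree f) div d. monom (coeff f (d * k)) k)"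

lemma coeff_block_poly:
  "coeff (block_poly d f) k = (if k < Suc (degree f) div d then coeff f (d * k) else 0)"
  by (simp add: block_poly_def coeff_sum)

text \<open>A coefficient can change only at an index divisible by \<open>d\<close>, where a new block starts.\<close>

lemma coeff_block:
  assumes f: "nondecreasing_coeffs f" and j: "j \<le> degree f"
  defines "d \<equiv> Gcd (increment_gaps f)"
  shows "coeff f j = coeff f (d * (j div d))"
  using j
proof (induction j)
  case (Suc j)
  show ?case
  proof (cases "d dvd Suc j")
    case False
    then have "increment f (Suc j) = 0"
      using Gcd_increment_gaps_dvd(2)[OF f Suc.prems] by (auto simp: d_def)
    moreover have "Suc j div d = j div d"
      using False by (simp add: div_Suc dvd_eq_mod_eq_0)
    ultimately show ?thesis
      using Suc by (simp add: increment_def)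
  qed simp
qed simp

lemma block_factorization:
  assumes f: "nondecreasing_coeffs f"
  defines "d \<equiv> Gcd (increment_gaps f)"
  shows "f = (\<Sum>i<d. monom 1 i) * pcompose (block_poly d f) (monom 1 d)"
proof -
  define m where "m = Suc (degree f) div d"
  have m: "m * d = Suc (degree f)"
    using Gcd_increment_gaps_dvd(1)[OF f] by (simp add: m_def d_def)
  have d: "d > 0" using Gcd_increment_gaps_pos[OF f] by (simp add: d_def)
  have comp: "pcompose (monom c k) (monom 1 d) = monom c (d * k)" for c :: real and k
    by (induction k) (simp_all add: monom_0 monom_Suc pcompose_pCons mult_monom)
  have "f = (\<Sum>j<m * d. monom (coeff f j) j)"
    unfolding m lessThan_Suc_atMost by (simp add: poly_as_sum_of_monoms)
  also have "\<dots> = (\<Sum>k<m. \<Sum>j=k * d..<k * d + d. monom (coeff f j) j)"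
    by (simp only: sum.nat_group)
  also have "\<dots> = (\<Sum>k<m. \<Sum>i<d. monom (coeff f (d * k)) (d * k + i))"
  proof (rule sum.cong)
    fix k assume k: "k \<in> {..<m}"
    have "(\<Sum>j=k * d..<k * d + d. monom (coeff f j) j) =
        (\<Sum>i<d. monom (coeff f (d * k + i)) (d * k + i))"
      by (rule sum.reindex_bij_witness[of _ "\<lambda>i. d * k + i" "\<lambda>j. j - d * k"])
        (auto simp: mult.commute)
    also have "\<dots> = (\<Sum>i<d. monom (coeff f (d * k)) (d * k + i))"
    proof (rule sum.cong)
      fix i assume i: "i \<in> {..<d}"
      have "Suc k * d \<le> m * d" using k by (intro mult_le_mono1) simp
      then have "d * k + i \<le> degree f"
        using i unfolding m by (simp add: mult.commute)
      then have "coeff f (d * k + i) = coeff f (d * ((d * k + i) div d))"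
        unfolding d_def by (rule coeff_block[OF f])
      then show "monom (coeff f (d * k + i)) (d * k + i) = monom (coeff f (d * k)) (d * k + i)"
        using i d by simp
    qed simp
    finally show "(\<Sum>j=k * d..<k * d + d. monom (coeff f j) j) =
        (\<Sum>i<d. monom (coeff f (d * k)) (d * k + i))" .
  qed simp
  also have "\<dots> = (\<Sum>i<d. monom 1 i) * (\<Sum>k<m. monom (coeff f (d * k)) (d * k))"
    by (subst sum.swap) (simp add: sum_product mult_monom add.commute)
  also have "(\<Sum>k<m. monom (coeff f (d * k)) (d * k)) =
      pcompose (block_poly d f) (monom 1 d)"
    by (simp add: block_poly_def m_def pcompose_sum comp)
  finally show ?thesis .
qed

lemma degree_block_poly:
  assumes f: "nondecreasing_coeffs f"
  defines "d \<equiv> Gcd (increment_gaps f)"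
  shows "Suc (degree (block_poly d f)) = Suc (degree f) div d"
proof -
  define m where "m = Suc (degree f) div d"
  have m: "m * d = Suc (degree f)"
    using Gcd_increment_gaps_dvd(1)[OF f] by (simp add: m_def d_def)
  then obtain k where k: "m = Suc k" by (cases m) auto
  have d: "d > 0" using Gcd_increment_gaps_pos[OF f] by (simp add: d_def)
  have "d * k \<le> degree f" using m d by (simp add: k mult.commute)
  then have "coeff (block_poly d f) k \<noteq> 0"
    using pos_coeffs_if_nondecreasing[OF f] k
    by (simp add: coeff_block_poly pos_coeffs_def flip: m_def) (metis less_irrefl)
  then have "k \<le> degree (block_poly d f)" by (rule le_degree)
  moreover have "degree (block_poly d f) \<le> k"
    by (rule degree_le) (simp add: coeff_block_poly k flip: m_def)
  ultimately show ?thesis by (simp add: k flip: m_def)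
qed

lemma nondecreasing_coeffs_mono:
  assumes f: "nondecreasing_coeffs f" and "i \<le> j" "j \<le> degree f"
  shows "coeff f i \<le> coeff f j"
  using \<open>i \<le> j\<close> \<open>j \<le> degree f\<close>
proof (induction j rule: dec_induct)
  case (step k)
  then have "coeff f k \<le> coeff f (Suc k)"
    using f by (simp add: nondecreasing_coeffs_def)
  with step show ?case by simp
qed simp

lemma nondecreasing_coeffs_block_poly:
  assumes f: "nondecreasing_coeffs f"
  defines "d \<equiv> Gcd (increment_gaps f)"
  shows "nondecreasing_coeffs (block_poly d f)"
  unfolding nondecreasing_coeffs_def
proof (intro conjI allI impI)
  have deg: "Suc (degree (block_poly d f)) = Suc (degree f) div d"
    unfolding d_def by (rule degree_block_poly[OF f])
  then show "coeff (block_poly d f) 0 > 0"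
    using f by (simp add: coeff_block_poly nondecreasing_coeffs_def flip: deg)
  fix k assume k: "k < degree (block_poly d f)"
  have "Suc k * d < Suc (degree (block_poly d f)) * d"
    using k Gcd_increment_gaps_pos[OF f] by (simp add: d_def)
  also have "\<dots> \<le> Suc (degree f)" unfolding deg by simp
  finally have "d * Suc k \<le> degree f" by (simp add: mult.commute)
  then show "coeff (block_poly d f) k \<le> coeff (block_poly d f) (Suc k)"
    using k by (simp add: coeff_block_poly nondecreasing_coeffs_mono[OF f] flip: deg)
qed

lemma coeff_ratio_max_le_1:
  assumes f: "nondecreasing_coeffs f" and deg: "degree f > 0"
  shows "coeff_ratio_max f \<le> 1"
  unfolding coeff_ratio_max_def
proof (subst Max_le_iff)
  show "\<forall>r\<in>(\<lambda>j. coeff f j / coeff f (j + 1)) ` {0..degree f - 1}. r \<le> 1"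
  proof
    fix r assume "r \<in> (\<lambda>j. coeff f j / coeff f (j + 1)) ` {0..degree f - 1}"
    then obtain j where "j \<le> degree f - 1" and r: "r = coeff f j / coeff f (Suc j)"
      by auto
    then have j: "j < degree f"
      using deg by simp
    have "coeff f (Suc j) > 0"
      using pos_coeffs_if_nondecreasing[OF f] j by (simp add: pos_coeffs_def)
    then show "r \<le> 1"
      using f j by (simp add: r nondecreasing_coeffs_def)
  qed
qed auto

lemma complex_nth_root_exists:
  assumes "n > 0"
  obtains z :: complex where "z ^ n = w"
proof
  show "rcis (root n (cmod w)) (Arg w / real n) ^ n = w"
    using assms by (simp add: DeMoivre2 rcis_cmod_Arg)
qed

text \<open>
  A \<open>d\<close>-th root of \<open>w\<close> is a root of \<open>f\<close>, so the location of the roots of \<open>f\<close> forces \<open>w = 1\<close> as soon as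
  \<open>|w| \<ge> 1\<close>.
\<close>

lemma block_poly_root_norm_less_1:
  assumes f: "nondecreasing_coeffs f"
  defines "d \<equiv> Gcd (increment_gaps f)"
  assumes root: "poly (cpoly (block_poly d f)) w = 0"
  shows "cmod w < 1"
proof (rule ccontr)
  assume "\<not> cmod w < 1"
  have d: "d > 0" using Gcd_increment_gaps_pos[OF f] by (simp add: d_def)
  then obtain z where z: "z ^ d = w"
    using complex_nth_root_exists by metis
  have "poly (cpoly f) z = poly (cpoly (\<Sum>i<d. monom 1 i)) z * poly (cpoly (block_poly d f)) (z ^ d)"
    by (subst block_factorization[OF f], fold d_def)
      (simp add: cpoly_mult cpoly_pcompose poly_pcompose map_poly_monom poly_monom)
  then have fz: "poly (cpoly f) z = 0"
    by (simp add: z root)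
  have "cmod z \<ge> 1"
    using \<open>\<not> cmod w < 1\<close> z d by (metis norm_ge_zero norm_power not_le power_Suc_less_one
        power_less_one_iff)
  then have "cmod z = 1"
    using root_norm_le_1[OF f fz] by simp
  then have w: "w = 1"
    using unit_root_power_eq_1[OF f fz] z by (simp add: d_def)
  have "poly (cpoly (block_poly d f)) 1 = of_real (poly (block_poly d f) 1)"
    unfolding poly_cpoly by (simp add: poly_altdef)
  moreover have "poly (block_poly d f) 1 > 0"
    unfolding d_def
    by (intro pos_coeffs_poly_1 pos_coeffs_if_nondecreasing nondecreasing_coeffs_block_poly f)
  ultimately show False using root w by simp
qed

section \<open>The Collatz polynomial\<close>

text \<open>The orbit does not vanish before it reaches \<open>1\<close>, because \<open>0\<close> is a fixed point.\<close>

lemma collatz_iterate_pos: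
  assumes "(collatz ^^ n) N = 1" and "j \<le> n"
  shows "(collatz ^^ j) N > 0"
proof (rule ccontr)
  assume "\<not> (collatz ^^ j) N > 0"
  then have j: "(collatz ^^ j) N = 0" by simp
  have zero: "(collatz ^^ k) 0 = 0" for k
    by (induction k) (simp_all add: collatz_def)
  have "(collatz ^^ n) N = (collatz ^^ (n - j + j)) N"
    using \<open>j \<le> n\<close> by simp
  also have "\<dots> = (collatz ^^ (n - j)) ((collatz ^^ j) N)"
    by (simp only: funpow_add comp_apply)
  also have "\<dots> = 0"
    by (simp only: j zero)
  finally show False
    using assms(1) by simp
qed

lemma collatz_time_finite:
  assumes "collatz_time N < \<infinity>"
  shows "(collatz ^^ the_enat (collatz_time N)) N = 1"
    and "j < the_enat (collatz_time N) \<Longrightarrow> (collatz ^^ j) N \<noteq> 1"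
proof -
  have ex: "\<exists>j. (collatz ^^ j) N = 1"
    using assms by (auto simp: collatz_time_def split: if_splits)
  then have n: "the_enat (collatz_time N) = (LEAST j. (collatz ^^ j) N = 1)"
    by (simp add: collatz_time_def)
  show "(collatz ^^ the_enat (collatz_time N)) N = 1"
    unfolding n using ex by (rule LeastI_ex)
  show "j < the_enat (collatz_time N) \<Longrightarrow> (collatz ^^ j) N \<noteq> 1"
    unfolding n by (rule not_less_Least)
qed

abbreviation (input) scaled_collatz_poly :: "nat \<Rightarrow> real poly" where
  "scaled_collatz_poly N \<equiv> pcompose (collatz_poly N) [:0, 2:]"

lemma coeff_scaled_collatz_poly:
  "coeff (scaled_collatz_poly N) j =
     (if j \<le> the_enat (collatz_time N) then 2 ^ j * real ((collatz ^^ j) N) else 0)"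
  by (simp add: coeff_pcompose_linear collatz_poly_def coeff_sum)

lemma degree_scaled_collatz_poly:
  assumes "collatz_time N < \<infinity>"
  shows "degree (scaled_collatz_poly N) = the_enat (collatz_time N)"
proof (rule antisym)
  show "degree (scaled_collatz_poly N) \<le> the_enat (collatz_time N)"
    by (rule degree_le) (simp add: coeff_scaled_collatz_poly)
  show "the_enat (collatz_time N) \<le> degree (scaled_collatz_poly N)"
    by (rule le_degree) (simp add: coeff_scaled_collatz_poly collatz_time_finite(1)[OF assms])
qed

lemma scaled_collatz_increment:
  assumes fin: "collatz_time N < \<infinity>" and j: "j < the_enat (collatz_time N)"
  shows "increment (scaled_collatz_poly N) (Suc j) =
     (if even ((collatz ^^ j) N) then 0 else 2 ^ j * (2 * real ((collatz ^^ j) N) + 1))"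
proof -
  let ?c = "(collatz ^^ j) N"
  have "?c \<noteq> 1" by (rule collatz_time_finite(2)[OF fin j])
  then have "2 * collatz ?c = (if even ?c then ?c else 3 * ?c + 1)"
    by (simp add: collatz_def)
  then have "real (2 * collatz ?c) = real (if even ?c then ?c else 3 * ?c + 1)"
    by (rule arg_cong)
  then have step: "2 * real (collatz ?c) = (if even ?c then real ?c else 3 * real ?c + 1)"
    by (simp split: if_splits)
  have "increment (scaled_collatz_poly N) (Suc j) = 2 ^ j * (2 * real (collatz ?c) - real ?c)"
    using j by (simp add: increment_def coeff_scaled_collatz_poly algebra_simps)
  then show ?thesis unfolding step by simp
qed

lemma nondecreasing_coeffs_scaled_collatz_poly:
  assumes fin: "collatz_time N < \<infinity>"
  shows "nondecreasing_coeffs (scaled_collatz_poly N)"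
  unfolding nondecreasing_coeffs_def
proof (intro conjI allI impI)
  show "coeff (scaled_collatz_poly N) 0 > 0"
    using collatz_iterate_pos[OF collatz_time_finite(1)[OF fin], of 0]
    by (simp only: coeff_scaled_collatz_poly) simp
  fix j assume "j < degree (scaled_collatz_poly N)"
  then have "increment (scaled_collatz_poly N) (Suc j) \<ge> 0"
    by (simp add: scaled_collatz_increment[OF fin] degree_scaled_collatz_poly[OF fin])
  then show "coeff (scaled_collatz_poly N) j \<le> coeff (scaled_collatz_poly N) (Suc j)"
    by (simp add: increment_def)
qed

lemma increment_gaps_scaled_collatz_poly:
  assumes fin: "collatz_time N < \<infinity>"
  shows "increment_gaps (scaled_collatz_poly N) = collatz_T N"
proof -
  define n where "n = the_enat (collatz_time N)"
  define f where "f = scaled_collatz_poly N"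
  have deg: "degree f = n"
    unfolding f_def n_def by (rule degree_scaled_collatz_poly[OF fin])
  have inc: "increment f (Suc j) \<noteq> 0 \<longleftrightarrow> odd ((collatz ^^ j) N)" if "j < n" for j
  proof -
    have "2 * real ((collatz ^^ j) N) + 1 > 0" by (simp add: add_nonneg_pos)
    then show ?thesis
      using scaled_collatz_increment[OF fin that[unfolded n_def]] by (simp add: f_def)
  qed
  have zero: "Suc n \<in> increment_gaps f"
    unfolding deg [symmetric] f_def
    by (intro Suc_degree_in_increment_gaps nondecreasing_coeffs_scaled_collatz_poly fin)
  have "i \<in> increment_gaps f \<longleftrightarrow> i = n + 1 \<or> i \<in> {1..n} \<and> odd ((collatz ^^ (n - i)) N)" for i
  proof
    assume "i \<in> increment_gaps f"
    then obtain j where j: "j \<le> n" "increment f j \<noteq> 0" "i = Suc n - j"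
      by (auto simp: increment_gaps_def deg)
    show "i = n + 1 \<or> i \<in> {1..n} \<and> odd ((collatz ^^ (n - i)) N)"
    proof (cases j)
      case (Suc k)
      then have "n - i = k" using j by simp
      with Suc j inc[of k] show ?thesis by auto
    qed (use j in simp)
  next
    assume i: "i = n + 1 \<or> i \<in> {1..n} \<and> odd ((collatz ^^ (n - i)) N)"
    show "i \<in> increment_gaps f"
    proof (cases "i = n + 1")
      case False
      with i have "i \<in> {1..n}" "increment f (Suc (n - i)) \<noteq> 0"
        using inc[of "n - i"] by auto
      then show ?thesis
        unfolding increment_gaps_def deg by (intro image_eqI[where x = "Suc (n - i)"]) auto
    qed (use zero in simp)
  qed
  then have "increment_gaps f = {n + 1} \<union> {j \<in> {1..n}. odd ((collatz ^^ (n - j)) N)}"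
    by auto
  then show ?thesis
    by (simp add: collatz_T_def Let_def f_def n_def)
qed

lemma cpoly_scaled_collatz_poly:
  "cpoly (scaled_collatz_poly N) = pcompose (cpoly (collatz_poly N)) [:0, 2:]"
  by (simp add: cpoly_pcompose map_poly_pCons)

lemma poly_scaled_collatz_poly:
  "poly (cpoly (scaled_collatz_poly N)) z = poly (cpoly (collatz_poly N)) (2 * z)"
  by (simp add: cpoly_scaled_collatz_poly poly_pcompose mult.commute)

lemma collatz_root_norm_2_iff:
  assumes fin: "collatz_time N < \<infinity>"
  shows "cmod z = 2 \<and> poly (cpoly (collatz_poly N)) z = 0
    \<longleftrightarrow> (\<exists>\<omega>. z = 2 * \<omega> \<and> \<omega> ^ collatz_d N = 1 \<and> \<omega> \<noteq> 1)"
proof -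
  have "cmod z = 2 \<and> poly (cpoly (collatz_poly N)) z = 0
      \<longleftrightarrow> poly (cpoly (scaled_collatz_poly N)) (z / 2) = 0 \<and> cmod (z / 2) = 1"
    by (auto simp: poly_scaled_collatz_poly norm_divide)
  also have "\<dots> \<longleftrightarrow> (z / 2) ^ collatz_d N = 1 \<and> z / 2 \<noteq> 1"
    unfolding unit_root_iff[OF nondecreasing_coeffs_scaled_collatz_poly[OF fin]]
      increment_gaps_scaled_collatz_poly[OF fin] collatz_d_def ..
  also have "\<dots> \<longleftrightarrow> (\<exists>\<omega>. z = 2 * \<omega> \<and> \<omega> ^ collatz_d N = 1 \<and> \<omega> \<noteq> 1)"
    by (auto intro: exI[of _ "z / 2"])
  finally show ?thesis .
qed

lemma collatz_root_norm_2_simple: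
  assumes fin: "collatz_time N < \<infinity>"
    and z: "cmod z = 2" and root: "poly (cpoly (collatz_poly N)) z = 0"
  shows "order z (cpoly (collatz_poly N)) = 1"
proof -
  let ?P = "cpoly (collatz_poly N)"
  have "poly (pderiv (cpoly (scaled_collatz_poly N))) (z / 2) \<noteq> 0"
    using z root
    by (intro pderiv_unit_root nondecreasing_coeffs_scaled_collatz_poly fin)
      (simp_all add: poly_scaled_collatz_poly norm_divide)
  then have "poly (pderiv ?P) z \<noteq> 0"
    by (simp add: cpoly_scaled_collatz_poly pderiv_pcompose poly_pcompose)
  then have "?P \<noteq> 0" and "order z (pderiv ?P) = 0"
    by (auto simp: order_root)
  then show ?thesis
    using order_pderiv[OF _ root] by simp
qed

lemma nontrivial_root_of_unity_exists_iff:
  assumes "d > 0"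
  shows "(\<exists>\<omega>::complex. \<omega> ^ d = 1 \<and> \<omega> \<noteq> 1) \<longleftrightarrow> d > 1"
proof
  assume "\<exists>\<omega>::complex. \<omega> ^ d = 1 \<and> \<omega> \<noteq> 1"
  with assms show "d > 1" by (cases "d = 1") auto
next
  assume "d > 1"
  have "\<not> {\<omega>::complex. \<omega> ^ d = 1} \<subseteq> {1}"
    using card_mono[of "{1}" "{\<omega>::complex. \<omega> ^ d = 1}"] card_roots_unity_eq[OF assms] \<open>d > 1\<close>
    by auto
  then show "\<exists>\<omega>::complex. \<omega> ^ d = 1 \<and> \<omega> \<noteq> 1" by blast
qed

theorem theorem3:
  fixes N :: nat
  assumes "\<forall>m>0. collatz_time m < \<infinity>"
    and "N \<ge> 2"
  shows "((\<exists>z::complex. poly (cpoly (collatz_poly N)) z = 0 \<and> cmod z = 2) \<longleftrightarrow> collatz_d N > 1)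
    \<and> (collatz_d N > 1 \<longrightarrow>
         {z::complex. cmod z = 2 \<and> poly (cpoly (collatz_poly N)) z = 0}
           = {2 * \<omega> | \<omega>::complex. \<omega> ^ collatz_d N = 1 \<and> \<omega> \<noteq> 1}
       \<and> (\<forall>z::complex. cmod z = 2 \<and> poly (cpoly (collatz_poly N)) z = 0
             \<longrightarrow> order z (cpoly (collatz_poly N)) = 1)
       \<and> (\<exists>Q::real poly. pos_coeffs Q
             \<and> pcompose (collatz_poly N) [:0, 2:]
                 = (\<Sum>j<collatz_d N. monom 1 j) * pcompose Q (monom 1 (collatz_d N))
             \<and> (degree Q > 0 \<longrightarrow>
                  (\<forall>z::complex. poly (cpoly Q) z = 0 \<longrightarrow> cmod z < 1)
                \<and> coeff_ratio_max Q \<le> 1)))"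
proof -
  let ?P = "cpoly (collatz_poly N)" and ?d = "collatz_d N"
  have fin: "collatz_time N < \<infinity>"
    using assms by simp
  note f = nondecreasing_coeffs_scaled_collatz_poly[OF fin]
  have d: "Gcd (increment_gaps (scaled_collatz_poly N)) = ?d"
    by (simp add: increment_gaps_scaled_collatz_poly[OF fin] collatz_d_def)
  have "?d > 0"
    using Gcd_increment_gaps_pos[OF f] by (simp add: d)
  then have exists_iff: "(\<exists>z. poly ?P z = 0 \<and> cmod z = 2) \<longleftrightarrow> ?d > 1"
    using collatz_root_norm_2_iff[OF fin] nontrivial_root_of_unity_exists_iff[of ?d] by metis
  have set_eq: "{z. cmod z = 2 \<and> poly ?P z = 0} = {2 * \<omega> | \<omega>. \<omega> ^ ?d = 1 \<and> \<omega> \<noteq> 1}"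
    using collatz_root_norm_2_iff[OF fin] by blast
  let ?Q = "block_poly ?d (scaled_collatz_poly N)"
  have Q: "nondecreasing_coeffs ?Q"
    using nondecreasing_coeffs_block_poly[OF f] by (simp add: d)
  have factor: "scaled_collatz_poly N = (\<Sum>j<?d. monom 1 j) * pcompose ?Q (monom 1 ?d)"
    using block_factorization[OF f] unfolding d .
  have "\<forall>z. poly (cpoly ?Q) z = 0 \<longrightarrow> cmod z < 1"
    using block_poly_root_norm_less_1[OF f] unfolding d by blast
  then have "\<exists>Q. pos_coeffs Q
      \<and> scaled_collatz_poly N = (\<Sum>j<?d. monom 1 j) * pcompose Q (monom 1 ?d)
      \<and> (degree Q > 0 \<longrightarrow>
          (\<forall>z. poly (cpoly Q) z = 0 \<longrightarrow> cmod z < 1) \<and> coeff_ratio_max Q \<le> 1)"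
    using pos_coeffs_if_nondecreasing[OF Q] factor coeff_ratio_max_le_1[OF Q]
    by (intro exI[of _ ?Q] conjI impI)
  with exists_iff set_eq collatz_root_norm_2_simple[OF fin] show ?thesis
    by blast
qed

end
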